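(* Let $q=q_1q_2\cdots q_k$ be a pattern such that either $\{1,k\}\neq\{q_1,q_k\}$, or $q$ is Wilf-equivalent to a pattern $v=v_1v_2\cdots v_k$ with $\{1,k\}\neq\{v_1,v_k\}$. Then the generating function $A_q(z)=\sum_{n\geq 0}\mathrm{Av}_n(q)z^n$ is not rational (that is, it is not the power series expansion of a quotient of two polynomials).
   Context: A permutation of length $n$ is written in one-line notation $p=p_1p_2\cdots p_n$ as an ordering of $1,2,\dots,n$. A pattern $q=q_1\cdots q_k$ is a permutation of length $k$. A permutation $p$ contains $q$ if there are indices $i_1<i_2<\cdots<i_k$ such that for all $r,s$, $p_{i_r}<p_{i_s}$ if and only if $q_r<q_s$; otherwise $p$ avoids $q$. $\mathrm{Av}_n(q)$ is the number of permutations of length $n$ that avoid $q$ (with $\mathrm{Av}_0(q)=1$, counting the empty permutation). Two patterns $q$ and $v$ are Wilf-equivalent if $\mathrm{Av}_n(q)=\mathrm{Av}_n(v)$ for all $n\ge 1$. *)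

theory Defs
  imports
    Complex_Main
    "HOL-Combinatorics.Multiset_Permutations"
    "HOL-Computational_Algebra.Polynomial_FPS"
begin

text \<open>
  A permutation of length \<open>n\<close> is its one-line notation, a list in
  \<^term>\<open>permutations_of_set {1..n::nat}\<close>. The entries are \<open>1..n\<close>, but list positions are
  counted from \<open>0\<close>, so the entry written \<open>p\<^sub>i\<close> on paper is \<open>p ! (i - 1)\<close>.
\<close>

abbreviation perms_of_length :: "nat \<Rightarrow> nat list set" where
  "perms_of_length n \<equiv> permutations_of_set {1..n}"

definition contains_pattern :: "nat list \<Rightarrow> nat list \<Rightarrow> bool" where
  "contains_pattern p q \<longleftrightarrow>
     (\<exists>i :: nat \<Rightarrow> nat.
        strict_mono_on {..<length q} i \<and>
        (\<forall>r < length q. i r < length p) \<and>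
        (\<forall>r < length q. \<forall>s < length q. p ! i r < p ! i s \<longleftrightarrow> q ! r < q ! s))"

abbreviation avoids_pattern :: "nat list \<Rightarrow> nat list \<Rightarrow> bool" where
  "avoids_pattern p q \<equiv> \<not> contains_pattern p q"

definition Av :: "nat \<Rightarrow> nat list \<Rightarrow> nat" where
  "Av n q = card {p \<in> perms_of_length n. avoids_pattern p q}"

definition wilf_equivalent :: "nat list \<Rightarrow> nat list \<Rightarrow> bool" where
  "wilf_equivalent q v \<longleftrightarrow> (\<forall>n\<ge>1. Av n q = Av n v)"

definition Av_gf :: "nat list \<Rightarrow> complex fps" where
  "Av_gf q = Abs_fps (\<lambda>n. of_nat (Av n q))"

text \<open>
  The quotient \<open>P / Q\<close> is taken in the fraction field of the integral domain of formal power
  series and written in cross-multiplied form, because the operation \<open>/\<close> on \<^typ>\<open>'a fps\<close>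
  truncates when its result would have a pole. Only \<open>Q \<noteq> 0\<close> is required: if \<open>Q\<close> has zero
  constant term, a common power of the variable can be cancelled.
\<close>

definition rational_fps :: "'a::field fps \<Rightarrow> bool" where
  "rational_fps A \<longleftrightarrow> (\<exists>P Q. Q \<noteq> 0 \<and> A * fps_of_poly Q = fps_of_poly P)"

lemma Av_0:
  assumes "q \<noteq> []"
  shows "Av 0 q = 1"
proof -
  have "avoids_pattern [] q"
    using assms by (auto simp: contains_pattern_def)
  then have "{p \<in> perms_of_length 0. avoids_pattern p q} = {[]}"
    by auto
  then show ?thesis
    by (simp add: Av_def)
qed

end

theory Submission
  imports
    Defs
    "HOL-Complex_Analysis.Cauchy_Integral_Formula"
    "HOL-Computational_Algebra.Fundamental_Theorem_Algebra"
begin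

text \<open>
  After replacing \<open>q\<close> by its reverse, its complement or both, \<open>q\<close> is skew indecomposable and does
  not end in its largest entry. Then \<open>(\<sigma> \<oplus> 1) \<ominus> \<pi>\<close> avoids \<open>q\<close> whenever \<open>\<sigma>\<close> and \<open>\<pi>\<close> do, and it
  determines \<open>\<sigma>\<close> and \<open>\<pi>\<close>, since they are separated by its largest entry. So the coefficients of
  \<open>A\<close> satisfy the Catalan recursion as an inequality, \<open>A(x) \<ge> 1 + x A(x)\<^sup>2\<close>, and \<open>A(x) \<le> 1 / x\<close>
  inside the disc of convergence. If \<open>A = P / Q\<close> in lowest terms, let \<open>w\<close> be a root of \<open>Q\<close> of
  least modulus. From \<open>\<bar>A(z)\<bar> \<le> 1 / \<bar>z\<bar>\<close> for \<open>\<bar>z\<bar> < \<bar>w\<bar>\<close> and \<open>P = A Q\<close> one gets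
  \<open>P(w) = 0\<close> on letting \<open>z\<close> tend to \<open>w\<close>, a contradiction.
\<close>

section \<open>Power series dominated by a Catalan-type recursion\<close>

text \<open>The Cauchy product turns the recursion into \<open>x * S^2 <= S - 1\<close> for the sum
  \<open>S\<close>: dropping the term \<open>a 0 = 1\<close> and shifting accounts for the
  right-hand side. Since \<open>S - 1 <= S\<close> and \<open>S >= 1\<close>, dividing by
  \<open>S\<close> leaves \<open>x * S <= 1\<close>.\<close>

lemma catalan_recursion_sum_bound:
  fixes a :: "nat \<Rightarrow> real"
  assumes nonneg: "\<And>n. a n \<ge> 0" and a0: "a 0 = 1"
    and rec: "\<And>n. (\<Sum>i\<le>n. a i * a (n - i)) \<le> a (Suc n)"
    and x: "x > 0" and summ: "summable (\<lambda>n. a n * x ^ n)"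
  shows "(\<Sum>n. a n * x ^ n) \<le> 1 / x"
proof -
  define S where "S = (\<Sum>n. a n * x ^ n)"
  have abs_summ: "summable (\<lambda>n. norm (a n * x ^ n))"
    using summ nonneg x by simp
  have conv: "(\<Sum>i\<le>n. a i * x ^ i * (a (n - i) * x ^ (n - i))) = x ^ n * (\<Sum>i\<le>n. a i * a (n - i))" for n
    by (simp add: sum_distrib_left power_add[symmetric] mult_ac)
  have "(\<lambda>n. x ^ n * (\<Sum>i\<le>n. a i * a (n - i))) sums (S * S)"
    using Cauchy_product_sums[OF abs_summ abs_summ] unfolding conv S_def .
  then have *: "(\<lambda>n. x * (x ^ n * (\<Sum>i\<le>n. a i * a (n - i)))) sums (x * (S * S))"
    by (rule sums_mult)
  have **: "(\<lambda>n. a (Suc n) * x ^ Suc n) sums (S - 1)"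
    using summ a0 by (subst sums_Suc_iff) (simp add: S_def summable_sums)
  have "x * (S * S) \<le> S - 1"
    using rec x by (intro sums_le[OF _ * **]) (simp add: mult_left_mono mult_ac)
  moreover have "1 \<le> S"
    using summ nonneg x a0 sum_le_suminf[of "\<lambda>n. a n * x ^ n" "{0}"] by (simp add: S_def)
  ultimately have "(x * S) * S \<le> 1 * S"
    by (simp only: mult.assoc mult_1)
  then have "x * S \<le> 1"
    using \<open>1 \<le> S\<close> by (subst (asm) mult_le_cancel_right) auto
  then show ?thesis
    using x by (simp add: S_def field_simps)
qed

text \<open>A denominator of least degree works: at a common root of \<open>P\<close> and
  \<open>Q\<close> a linear factor could be cancelled, power series over a field having no zero
  divisors, and this would lower the degree.\<close>

lemma rational_fps_reduced:
  assumes "rational_fps (A :: 'a::field fps)"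
  obtains P Q where "Q \<noteq> 0" "A * fps_of_poly Q = fps_of_poly P"
    "\<And>z. poly Q z = 0 \<Longrightarrow> poly P z \<noteq> 0"
proof -
  define good where "good = (\<lambda>Q :: 'a poly. Q \<noteq> 0 \<and> (\<exists>P. A * fps_of_poly Q = fps_of_poly P))"
  obtain Q0 where "good Q0"
    using assms by (auto simp: good_def rational_fps_def)
  then obtain Q where Q: "good Q" and minimal: "\<And>Q'. good Q' \<Longrightarrow> degree Q \<le> degree Q'"
    using ex_has_least_nat[of good Q0 degree] by blast
  then obtain P where P: "A * fps_of_poly Q = fps_of_poly P"
    by (auto simp: good_def)
  have "poly P z \<noteq> 0" if "poly Q z = 0" for z
  proof
    assume "poly P z = 0"
    with that obtain P' Q' where fac: "P = [:-z, 1:] * P'" "Q = [:-z, 1:] * Q'"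
      unfolding poly_eq_0_iff_dvd dvd_def by blast
    then have "fps_of_poly [:-z, 1:] * (A * fps_of_poly Q') = fps_of_poly [:-z, 1:] * fps_of_poly P'"
      using P by (simp only: fps_of_poly_mult mult_ac)
    then have "A * fps_of_poly Q' = fps_of_poly P'"
      by (subst (asm) mult_cancel_left) simp
    moreover have "Q' \<noteq> 0"
      using Q fac by (auto simp: good_def)
    ultimately have "degree Q \<le> degree Q'"
      by (intro minimal) (auto simp: good_def)
    moreover have "degree Q = Suc (degree Q')"
      unfolding fac using \<open>Q' \<noteq> 0\<close> by (subst degree_mult_eq) auto
    ultimately show False
      by simp
  qed
  then show ?thesis
    using Q P that by (auto simp: good_def)
qed

section \<open>Zeros of the denominator and the disc of convergence\<close>

lemma poly_min_modulus_root:
  fixes Q :: "complex poly"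
  assumes "degree Q > 0"
  obtains w where "poly Q w = 0" "\<And>z. poly Q z = 0 \<Longrightarrow> norm w \<le> norm z"
proof -
  let ?R = "{z. poly Q z = 0}"
  have "finite ?R"
    using assms by (intro poly_roots_finite) auto
  moreover have "?R \<noteq> {}"
    using assms fundamental_theorem_of_algebra[of Q] by (auto simp: constant_degree)
  ultimately obtain w where "w \<in> ?R" "\<forall>z\<in>?R. norm w \<le> norm z"
    using ex_min_if_finite[of "norm ` ?R"] by (auto simp: not_less)
  then show ?thesis
    using that by blast
qed

text \<open>A nonzero constant term makes \<open>Q\<close> invertible as a power series, so
  \<open>A\<close> is \<open>P\<close> times the inverse of \<open>Q\<close>; that inverse converges
  on every disc around 0 free of zeros of \<open>Q\<close>, and \<open>P\<close> converges
  everywhere.\<close>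

lemma fps_conv_radius_rational:
  fixes A :: "complex fps"
  assumes "A * fps_of_poly Q = fps_of_poly P" "poly Q 0 \<noteq> 0"
    and "\<And>z. poly Q z = 0 \<Longrightarrow> r \<le> norm z"
  shows "fps_conv_radius A \<ge> ereal r"
proof (cases "r > 0")
  case True
  have nonzero: "poly Q z \<noteq> 0" if "norm z < r" for z
    using assms(3)[of z] that by auto
  have "fps_of_poly Q * inverse (fps_of_poly Q) = 1"
    using assms(2) by (intro inverse_mult_eq_1') (simp add: poly_0_coeff_0)
  then have A: "A = fps_of_poly P * inverse (fps_of_poly Q)"
    unfolding assms(1)[symmetric] by (simp add: mult.assoc)
  have "ereal r \<le> fps_conv_radius (inverse (fps_of_poly Q))"
    using fps_conv_radius_inverse[of "ereal r" "fps_of_poly Q"] True nonzero by simp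
  then show ?thesis
    unfolding A by (intro order_trans[OF _ fps_conv_radius_mult]) simp
next
  case False
  then show ?thesis
    using order_trans[of "ereal r" 0, OF _ conv_radius_nonneg] by (simp add: fps_conv_radius_def)
qed

theorem catalan_recursion_not_rational:
  fixes a :: "nat \<Rightarrow> nat"
  assumes a0: "a 0 = 1" and rec: "\<And>n. (\<Sum>i\<le>n. a i * a (n - i)) \<le> a (Suc n)"
  shows "\<not> rational_fps (Abs_fps (\<lambda>n. of_nat (a n)) :: complex fps)"
proof
  define A :: "complex fps" where "A = Abs_fps (\<lambda>n. of_nat (a n))"
  assume "rational_fps (Abs_fps (\<lambda>n. of_nat (a n)) :: complex fps)"
  then obtain P Q where "Q \<noteq> 0" and PQ: "A * fps_of_poly Q = fps_of_poly P"
    and coprime: "\<And>z. poly Q z = 0 \<Longrightarrow> poly P z \<noteq> 0"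
    unfolding A_def by (rule rational_fps_reduced) blast
  \<comment> \<open>Comparing constant terms in \<open>A * Q = P\<close> shows that a zero of
    \<open>Q\<close> at 0 would also be a zero of \<open>P\<close>.\<close>
  have Q0: "poly Q 0 \<noteq> 0"
  proof
    assume "poly Q 0 = 0"
    moreover have "poly P 0 = fps_nth (A * fps_of_poly Q) 0"
      by (simp add: PQ poly_0_coeff_0)
    ultimately show False
      using coprime[of 0] by (simp add: poly_0_coeff_0)
  qed
  have pos: "a n \<ge> 1" for n
  proof (induction n)
    case (Suc n)
    have "a 0 * a (n - 0) \<le> (\<Sum>i\<le>n. a i * a (n - i))"
      by (rule member_le_sum) auto
    then show ?case
      using rec[of n] Suc a0 by simp
  qed (simp add: a0)
  \<comment> \<open>For constant \<open>Q\<close> the series \<open>A\<close> would be a polynomial,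
    but all its coefficients are positive, including the one just beyond
    \<open>degree P\<close>.\<close>
  have "degree Q > 0"
  proof (rule ccontr)
    assume "\<not> degree Q > 0"
    then obtain c where c: "Q = [:c:]" "c \<noteq> 0"
      using \<open>Q \<noteq> 0\<close> by (auto elim: degree_eq_zeroE)
    have "fps_nth (A * fps_of_poly Q) (Suc (degree P)) = 0"
      by (simp add: PQ coeff_eq_0)
    then show False
      using c pos[of "Suc (degree P)"] by (simp add: A_def fps_of_poly_const)
  qed
  then obtain w where w: "poly Q w = 0" and w_min: "\<And>z. poly Q z = 0 \<Longrightarrow> norm w \<le> norm z"
    by (rule poly_min_modulus_root) blast
  have "w \<noteq> 0"
    using w Q0 by auto
  have radius: "ereal (norm w) \<le> fps_conv_radius A"
    using PQ Q0 w_min by (rule fps_conv_radius_rational)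
  \<comment> \<open>The coefficients are nonnegative, so the modulus of \<open>A\<close> at
    \<open>z\<close> is at most the value of \<open>A\<close> at \<open>norm z\<close>, where the
    real estimate applies.\<close>
  have bound: "norm (eval_fps A z) \<le> 1 / norm z" if z: "norm z < norm w" "z \<noteq> 0" for z
  proof -
    have "ereal (norm z) < fps_conv_radius A"
      using z(1) by (intro less_le_trans[OF _ radius]) simp
    then have summ: "summable (\<lambda>n. norm (fps_nth A n * z ^ n))"
      by (rule norm_summable_fps)
    have eq: "norm (fps_nth A n * z ^ n) = real (a n) * norm z ^ n" for n
      by (simp add: A_def norm_mult norm_power)
    have "norm (eval_fps A z) \<le> (\<Sum>n. norm (fps_nth A n * z ^ n))"
      unfolding eval_fps_def using summ by (rule summable_norm)
    also have "\<dots> \<le> 1 / norm z"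
      unfolding eq
    proof (rule catalan_recursion_sum_bound)
      show "(\<Sum>i\<le>n. real (a i) * real (a (n - i))) \<le> real (a (Suc n))" for n
        using rec[of n] by (simp flip: of_nat_mult of_nat_sum)
    qed (use summ a0 z in \<open>simp_all add: eq\<close>)
    finally show ?thesis .
  qed
  have poly_bound: "norm (poly P z) \<le> norm (poly Q z) / norm z" if z: "norm z < norm w" "z \<noteq> 0" for z
  proof -
    have "ereal (norm z) < fps_conv_radius A"
      using z(1) by (intro less_le_trans[OF _ radius]) simp
    then have "poly P z = eval_fps A z * poly Q z"
      using eval_fps_mult[of z A "fps_of_poly Q"] by (simp add: PQ)
    then show ?thesis
      using mult_right_mono[OF bound[OF z], of "norm (poly Q z)"] by (simp add: norm_mult)
  qed
  \<comment> \<open>Approach \<open>w\<close> along its radius from inside the disc. In the limit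
    \<open>poly_bound\<close> holds at \<open>w\<close> itself, where its right-hand side is 0, so
    \<open>P\<close> vanishes there too.\<close>
  have lim: "((\<lambda>t::real. of_real t * w) \<longlongrightarrow> w) (at_left 1)"
    by (auto intro!: tendsto_eq_intros)
  have ev: "eventually (\<lambda>t::real. t \<in> {0<..<1}) (at_left 1)"
    by (rule eventually_at_leftI[of 0]) auto
  have "norm (poly P w) \<le> norm (poly Q w) / norm w"
  proof (rule tendsto_le)
    show "((\<lambda>t. norm (poly P (of_real t * w))) \<longlongrightarrow> norm (poly P w)) (at_left (1::real))"
      by (intro tendsto_intros lim)
    show "((\<lambda>t. norm (poly Q (of_real t * w)) / norm (of_real t * w)) \<longlongrightarrow>
        norm (poly Q w) / norm w) (at_left (1::real))"
      using \<open>w \<noteq> 0\<close> by (intro tendsto_intros lim) auto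
    show "eventually (\<lambda>t. norm (poly P (of_real t * w)) \<le>
        norm (poly Q (of_real t * w)) / norm (of_real t * w)) (at_left (1::real))"
      using ev by eventually_elim (use \<open>w \<noteq> 0\<close> in \<open>intro poly_bound, simp_all add: norm_mult\<close>)
  qed auto
  then show False
    using w coprime[OF w] by simp
qed

section \<open>Symmetries of pattern avoidance\<close>

declare One_nat_def [simp del]

text \<open>Subtraction on naturals truncates. For a permutation this is harmless, as no entry
  exceeds its length; the lemmas on order and involution are therefore restricted to
  permutations.\<close>

definition complement :: "nat list \<Rightarrow> nat list" where
  "complement p = map (\<lambda>x. Suc (length p) - x) p"

lemma length_complement [simp]: "length (complement p) = length p"
  by (simp add: complement_def)

lemma perms_of_length_iff: "p \<in> perms_of_length n \<longleftrightarrow> set p = {1..n} \<and> distinct p"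
  by (auto simp: permutations_of_set_def)

lemma length_perm: "p \<in> perms_of_length n \<Longrightarrow> length p = n"
  by (simp add: length_finite_permutations_of_set)

lemma perm_nth_bounds:
  assumes "p \<in> perms_of_length n" "i < n"
  shows "1 \<le> p ! i" "p ! i \<le> n"
  using assms nth_mem[of i p] length_perm[OF assms(1)] by (auto simp: perms_of_length_iff)

lemma complement_nth: "i < length p \<Longrightarrow> complement p ! i = Suc (length p) - p ! i"
  by (simp add: complement_def)

lemma complement_nth_less_iff:
  assumes "p \<in> perms_of_length n" "i < n" "j < n"
  shows "complement p ! i < complement p ! j \<longleftrightarrow> p ! j < p ! i"
  using perm_nth_bounds[OF assms(1,2)] perm_nth_bounds[OF assms(1,3)] assms length_perm[OF assms(1)]
  by (simp add: complement_nth) arith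

lemma rev_perm: "p \<in> perms_of_length n \<Longrightarrow> rev p \<in> perms_of_length n"
  by (simp add: perms_of_length_iff)

lemma complement_perm:
  assumes "p \<in> perms_of_length n"
  shows "complement p \<in> perms_of_length n"
proof -
  have "(\<lambda>x. Suc n - x) ` {1..n} = {1..n}"
  proof (intro equalityI subsetI)
    fix x assume "x \<in> {1..n}"
    then show "x \<in> (\<lambda>x. Suc n - x) ` {1..n}"
      by (intro image_eqI[of _ _ "Suc n - x"]) auto
  qed auto
  then show ?thesis
    using assms length_perm[OF assms]
    by (auto simp: complement_def perms_of_length_iff distinct_map inj_on_def)
qed

lemma complement_complement:
  assumes "p \<in> perms_of_length n"
  shows "complement (complement p) = p"
  using perm_nth_bounds[OF assms] length_perm[OF assms]
  by (intro nth_equalityI) (auto simp: complement_nth Suc_diff_le)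

lemma contains_pattern_rev:
  assumes "contains_pattern p q"
  shows "contains_pattern (rev p) (rev q)"
proof -
  obtain i where mono: "strict_mono_on {..<length q} i"
    and bd: "\<And>r. r < length q \<Longrightarrow> i r < length p"
    and ord: "\<And>r s. r < length q \<Longrightarrow> s < length q \<Longrightarrow> p ! i r < p ! i s \<longleftrightarrow> q ! r < q ! s"
    using assms unfolding contains_pattern_def by auto
  \<comment> \<open>Mirror the position in \<open>q\<close>, apply \<open>i\<close>, then mirror the
    result in \<open>p\<close>; the two order reversals cancel, so \<open>j\<close> is
    increasing.\<close>
  define j where "j = (\<lambda>r. length p - Suc (i (length q - Suc r)))"
  show ?thesis
    unfolding contains_pattern_def
  proof (intro exI conjI allI impI)
    show "strict_mono_on {..<length (rev q)} j"
    proof (rule strict_mono_onI)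
      fix r s assume "r \<in> {..<length (rev q)}" "s \<in> {..<length (rev q)}" "r < s"
      then have "i (length q - Suc s) < i (length q - Suc r)" "i (length q - Suc r) < length p"
        by (auto intro!: strict_mono_onD[OF mono] bd)
      then show "j r < j s"
        unfolding j_def by linarith
    qed
    show "j r < length (rev p)" if "r < length (rev q)" for r
    proof -
      have "i (length q - Suc r) < length p"
        using that by (intro bd) simp
      then show ?thesis
        by (simp add: j_def)
    qed
    show "rev p ! j r < rev p ! j s \<longleftrightarrow> rev q ! r < rev q ! s"
      if "r < length (rev q)" "s < length (rev q)" for r s
    proof -
      have less: "length q - Suc r < length q" "length q - Suc s < length q"
        using that by simp_all
      show ?thesis
        using that bd[OF less(1)] bd[OF less(2)] ord[OF less]
        by (simp add: j_def rev_nth Suc_diff_Suc)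
    qed
  qed
qed

text \<open>The same positions \<open>i\<close> serve: complementing reverses every comparison in
  \<open>p\<close> and in \<open>q\<close> alike, which is why \<open>ord\<close> is used with
  \<open>r\<close> and \<open>s\<close> exchanged.\<close>

lemma contains_pattern_complement:
  assumes p: "p \<in> perms_of_length n" and q: "q \<in> perms_of_length k" and "contains_pattern p q"
  shows "contains_pattern (complement p) (complement q)"
proof -
  obtain i where mono: "strict_mono_on {..<length q} i"
    and bd: "\<And>r. r < length q \<Longrightarrow> i r < length p"
    and ord: "\<And>r s. r < length q \<Longrightarrow> s < length q \<Longrightarrow> p ! i r < p ! i s \<longleftrightarrow> q ! r < q ! s"
    using assms(3) unfolding contains_pattern_def by auto
  have "complement p ! i r < complement p ! i s \<longleftrightarrow> complement q ! r < complement q ! s"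
    if "r < length q" "s < length q" for r s
    using that bd ord[of s r] complement_nth_less_iff[OF p] complement_nth_less_iff[OF q]
    by (simp add: length_perm[OF p] length_perm[OF q])
  then show ?thesis
    unfolding contains_pattern_def using mono bd by (intro exI[of _ i] conjI allI impI) simp_all
qed

section \<open>Invariance of containment and of \<open>Av\<close> under reversal and
  complement\<close>

lemma contains_pattern_rev_iff: "contains_pattern (rev p) (rev q) \<longleftrightarrow> contains_pattern p q"
  using contains_pattern_rev[of p q] contains_pattern_rev[of "rev p" "rev q"] by auto

lemma contains_pattern_complement_iff:
  assumes p: "p \<in> perms_of_length n" and q: "q \<in> perms_of_length k"
  shows "contains_pattern (complement p) (complement q) \<longleftrightarrow> contains_pattern p q"
  using contains_pattern_complement[OF p q]
    contains_pattern_complement[OF complement_perm[OF p] complement_perm[OF q]]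
  by (auto simp: complement_complement[OF p] complement_complement[OF q])

lemma Av_rev: "Av n (rev q) = Av n q"
proof -
  have "bij_betw rev {p \<in> perms_of_length n. avoids_pattern p q}
      {p \<in> perms_of_length n. avoids_pattern p (rev q)}"
    by (rule bij_betw_byWitness[where f' = rev])
      (use contains_pattern_rev_iff[of _ "rev q"] in \<open>auto simp: rev_perm contains_pattern_rev_iff\<close>)
  then show ?thesis
    unfolding Av_def by (simp add: bij_betw_same_card)
qed

lemma Av_complement:
  assumes q: "q \<in> perms_of_length k"
  shows "Av n (complement q) = Av n q"
proof -
  have "bij_betw complement {p \<in> perms_of_length n. avoids_pattern p q}
      {p \<in> perms_of_length n. avoids_pattern p (complement q)}"
  proof (rule bij_betw_byWitness[where f' = complement])
    show "complement ` {p \<in> perms_of_length n. avoids_pattern p q} \<subseteq>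
        {p \<in> perms_of_length n. avoids_pattern p (complement q)}"
      using q by (auto simp: complement_perm contains_pattern_complement_iff)
    show "complement ` {p \<in> perms_of_length n. avoids_pattern p (complement q)} \<subseteq>
        {p \<in> perms_of_length n. avoids_pattern p q}"
      using contains_pattern_complement_iff[OF _ complement_perm[OF q]]
      by (auto simp: complement_perm complement_complement[OF q])
  qed (auto simp: complement_complement)
  then show ?thesis
    unfolding Av_def by (simp add: bij_betw_same_card)
qed

section \<open>Skew indecomposable patterns\<close>

text \<open>This says that \<open>q\<close> is order isomorphic to a skew sum of two nonempty
  patterns, the first of length \<open>c\<close>.\<close>

definition skew_decomposable :: "nat list \<Rightarrow> bool" where
  "skew_decomposable q \<longleftrightarrow>
     (\<exists>c. 0 < c \<and> c < length q \<and> (\<forall>r < c. \<forall>s. c \<le> s \<and> s < length q \<longrightarrow> q ! s < q ! r))"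

text \<open>The first entry lies before every cut and the last one after it. Reversal and complement
  each exchange which of the two is larger, so both turn a skew decomposable pattern into an
  indecomposable one.\<close>

lemma skew_decomposable_hd_last: "skew_decomposable q \<Longrightarrow> last q < hd q"
proof -
  assume "skew_decomposable q"
  then obtain c where c: "0 < c" "c < length q"
    and dec: "\<And>r s. r < c \<Longrightarrow> c \<le> s \<Longrightarrow> s < length q \<Longrightarrow> q ! s < q ! r"
    unfolding skew_decomposable_def by blast
  have "q ! (length q - 1) < q ! 0"
    using c by (intro dec) auto
  moreover have "q \<noteq> []"
    using c by auto
  ultimately show ?thesis
    by (simp add: hd_conv_nth last_conv_nth)
qed

text \<open>The reverse complement is a half turn of the diagram: it keeps skew sums and moves a cut
  at \<open>c\<close> to a cut at \<open>k - c\<close>.\<close>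

lemma skew_decomposable_complement_rev:
  assumes q: "q \<in> perms_of_length k" and "skew_decomposable (complement (rev q))"
  shows "skew_decomposable q"
proof -
  note len = length_perm[OF q]
  obtain c where c: "0 < c" "c < k"
    and dec: "\<And>r s. r < c \<Longrightarrow> c \<le> s \<Longrightarrow> s < k \<Longrightarrow> complement (rev q) ! s < complement (rev q) ! r"
    using assms(2) len unfolding skew_decomposable_def by auto
  have "q ! s < q ! r" if "r < k - c" "k - c \<le> s" "s < k" for r s
  proof -
    have "complement (rev q) ! (k - Suc r) < complement (rev q) ! (k - Suc s)"
      using that c by (intro dec) auto
    then have "rev q ! (k - Suc s) < rev q ! (k - Suc r)"
      using that complement_nth_less_iff[OF rev_perm[OF q], of "k - Suc r" "k - Suc s"] by simp
    then show ?thesis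
      using that len by (simp add: rev_nth Suc_diff_Suc)
  qed
  then show ?thesis
    unfolding skew_decomposable_def using c len by (intro exI[of _ "k - c"]) auto
qed

lemma hd_complement:
  "p \<noteq> [] \<Longrightarrow> hd (complement p) = Suc (length p) - hd p"
  by (simp add: complement_def hd_map)

lemma last_complement:
  "p \<noteq> [] \<Longrightarrow> last (complement p) = Suc (length p) - last p"
  by (simp add: complement_def last_map)

text \<open>In the notation of direct and skew sums, this is \<open>(\<sigma> \<oplus> 1) \<ominus> \<pi>\<close>.\<close>

definition skew_glue :: "nat list \<Rightarrow> nat list \<Rightarrow> nat list" where
  "skew_glue \<sigma> \<pi> = map (\<lambda>x. x + length \<pi>) \<sigma> @ Suc (length \<sigma> + length \<pi>) # \<pi>"

section \<open>Gluing two avoiders\<close>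

lemma skew_glue_perm:
  assumes "\<sigma> \<in> perms_of_length m" "\<pi> \<in> perms_of_length n"
  shows "skew_glue \<sigma> \<pi> \<in> perms_of_length (Suc (m + n))"
proof -
  have "(\<lambda>x. x + n) ` {1..m} = {Suc n..m + n}"
    using image_add_atLeastAtMost'[of n 1 m] by simp
  then show ?thesis
    using assms length_perm[OF assms(1)] length_perm[OF assms(2)]
    by (auto simp: perms_of_length_iff skew_glue_def distinct_map)
qed

lemma skew_glue_inject:
  assumes "\<sigma> \<in> perms_of_length m" "\<pi> \<in> perms_of_length n"
    and "\<sigma>' \<in> perms_of_length m'" "\<pi>' \<in> perms_of_length n'" "m + n = m' + n'"
    and eq: "skew_glue \<sigma> \<pi> = skew_glue \<sigma>' \<pi>'"
  shows "\<sigma> = \<sigma>' \<and> \<pi> = \<pi>'"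
proof -
  note len = length_perm[OF assms(1)] length_perm[OF assms(2)]
    length_perm[OF assms(3)] length_perm[OF assms(4)]
  have "map (\<lambda>x. x + n) \<sigma> @ Suc (m + n) # \<pi> = map (\<lambda>x. x + n') \<sigma>' @ Suc (m + n) # \<pi>'"
    using eq len assms(5) by (simp add: skew_glue_def)
  \<comment> \<open>The largest entry occurs in none of the other places, so both lists split there
    in the same way. Then \<open>\<pi> = \<pi>'\<close> yields \<open>n = n'\<close>, and the shifts
    agree as well.\<close>
  then have "map (\<lambda>x. x + n) \<sigma> = map (\<lambda>x. x + n') \<sigma>' \<and> \<pi> = \<pi>'"
    using assms(1,2) by (subst (asm) append_Cons_eq_iff) (auto simp: perms_of_length_iff)
  then show ?thesis
    using len by (auto simp: inj_def)
qed

text \<open>Locate an occurrence \<open>f\<close> of \<open>q\<close> relative to position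
  \<open>m\<close> of the largest entry. Strictly right of \<open>m\<close> it lies in
  \<open>\<pi>\<close>, strictly left of \<open>m\<close> in \<open>\<sigma>\<close>. If it ends at
  \<open>m\<close>, then \<open>q\<close> ends in its maximum. If it starts at or before
  \<open>m\<close> and ends after it, then \<open>q\<close> is cut into a high and a low
  block.\<close>

lemma skew_glue_avoids:
  assumes \<sigma>: "\<sigma> \<in> perms_of_length m" and \<pi>: "\<pi> \<in> perms_of_length n" and q: "q \<in> perms_of_length k"
    and "k > 0" and indec: "\<not> skew_decomposable q" and last: "last q \<noteq> k"
    and av: "avoids_pattern \<sigma> q" "avoids_pattern \<pi> q"
  shows "avoids_pattern (skew_glue \<sigma> \<pi>) q"
proof
  let ?p = "skew_glue \<sigma> \<pi>"
  note len = length_perm[OF \<sigma>] length_perm[OF \<pi>] length_perm[OF q]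
  have lenp: "length ?p = Suc (m + n)"
    using len by (simp add: skew_glue_def)
  have left: "?p ! i = \<sigma> ! i + n" if "i < m" for i
    using that len by (simp add: skew_glue_def nth_append)
  have top: "?p ! m = Suc (m + n)"
    using len by (simp add: skew_glue_def nth_append)
  have right: "?p ! i = \<pi> ! (i - Suc m)" if "m < i" for i
    using that len by (simp add: skew_glue_def nth_append nth_Cons' One_nat_def)
  have left_bounds: "n < ?p ! i \<and> ?p ! i \<le> m + n" if "i < m" for i
    using left[OF that] perm_nth_bounds[OF \<sigma> that] by simp
  have right_bound: "?p ! i \<le> n" if "m < i" "i < Suc (m + n)" for i
    using right[OF that(1)] perm_nth_bounds[OF \<pi>, of "i - Suc m"] that by simp
  assume "contains_pattern ?p q"
  then obtain f where mono: "strict_mono_on {..<k} f"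
    and bd: "\<And>r. r < k \<Longrightarrow> f r < Suc (m + n)"
    and ord: "\<And>r s. r < k \<Longrightarrow> s < k \<Longrightarrow> ?p ! f r < ?p ! f s \<longleftrightarrow> q ! r < q ! s"
    unfolding contains_pattern_def lenp len by blast
  have f_less: "f r < f s" if "r < s" "s < k" for r s
    using strict_mono_onD[OF mono] that by auto
  consider "m < f 0" | "f 0 \<le> m" "m < f (k - 1)" | "f (k - 1) = m" | "f (k - 1) < m"
    by linarith
  then show False
  proof cases
    case 1
    have gt: "m < f r" if "r < k" for r
      using 1 f_less[of 0 r] that by (cases "r = 0") auto
    have "contains_pattern \<pi> q"
      unfolding contains_pattern_def len
    proof (intro exI[of _ "\<lambda>r. f r - Suc m"] conjI allI impI)
      show "strict_mono_on {..<k} (\<lambda>r. f r - Suc m)"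
        using gt f_less by (intro strict_mono_onI diff_less_mono) (auto simp: Suc_le_eq)
      show "f r - Suc m < n" if "r < k" for r
        using gt[OF that] bd[OF that] by linarith
      show "\<pi> ! (f r - Suc m) < \<pi> ! (f s - Suc m) \<longleftrightarrow> q ! r < q ! s" if "r < k" "s < k" for r s
        using ord[OF that] right[OF gt[OF that(1)]] right[OF gt[OF that(2)]] by simp
    qed
    with av show False
      by simp
  next
    case 2
    \<comment> \<open>The cut is the first letter of \<open>q\<close> placed beyond
      \<open>m\<close>: entries up to position \<open>m\<close> exceed \<open>n\<close>, later ones
      do not.\<close>
    define c where "c = (LEAST r. m < f r)"
    have c: "m < f c" "c \<le> k - 1"
      unfolding c_def using 2 by (auto intro: LeastI Least_le)
    have before: "f r \<le> m" if "r < c" for r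
      using not_less_Least[of r "\<lambda>r. m < f r"] that by (auto simp: c_def)
    have "q ! s < q ! r" if rs: "r < c" "c \<le> s" "s < k" for r s
    proof -
      have "m < f s"
        using c f_less[of c s] rs by (cases "c = s") auto
      then have "?p ! f s \<le> n"
        using right_bound bd rs by simp
      also have "n < ?p ! f r"
        using before[OF rs(1)] left_bounds[of "f r"] top by (cases "f r = m") auto
      finally show ?thesis
        using ord[of s r] rs by simp
    qed
    moreover have "0 < c"
      using c 2 by (cases "c = 0") auto
    ultimately have "skew_decomposable q"
      unfolding skew_decomposable_def len using c \<open>k > 0\<close> by (intro exI[of _ c]) auto
    with indec show False ..
  next
    case 3
    \<comment> \<open>The last letter of \<open>q\<close> sits on the largest entry, so it exceeds
      all other letters and has to be \<open>k\<close>.\<close>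
    have lt: "q ! r < last q" if "r < k - 1" for r
    proof -
      have "?p ! f r < ?p ! f (k - 1)"
        using f_less[of r "k - 1"] that 3 top left_bounds[of "f r"] by simp
      then show ?thesis
        using ord[of r "k - 1"] that len by (subst last_conv_nth) auto
    qed
    have "k \<in> set q"
      using q \<open>k > 0\<close> by (auto simp: perms_of_length_iff)
    then obtain r where r: "r < k" "q ! r = k"
      using len by (auto simp: in_set_conv_nth)
    have "last q \<le> k"
      using q \<open>k > 0\<close> last_in_set[of q] len by (auto simp: perms_of_length_iff)
    then have "r = k - 1"
      using lt[of r] r by linarith
    then show False
      using r last len by (subst (asm) last_conv_nth) auto
  next
    case 4
    have lt: "f r < m" if "r < k" for r
      using 4 f_less[of r "k - 1"] that by (cases "r = k - 1") force+
    have "contains_pattern \<sigma> q"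
      unfolding contains_pattern_def len
    proof (intro exI[of _ f] conjI allI impI)
      show "\<sigma> ! f r < \<sigma> ! f s \<longleftrightarrow> q ! r < q ! s" if "r < k" "s < k" for r s
        using ord[OF that] left[OF lt[OF that(1)]] left[OF lt[OF that(2)]] by simp
    qed (use mono lt in auto)
    with av show False
      by simp
  qed
qed

text \<open>Gluing embeds the disjoint union of the products of avoiders of lengths \<open>i\<close>
  and \<open>n - i\<close> into the avoiders of length \<open>Suc n\<close>.\<close>

lemma Av_catalan_recursion:
  assumes q: "q \<in> perms_of_length k" "k > 0" "\<not> skew_decomposable q" "last q \<noteq> k"
  shows "(\<Sum>i\<le>n. Av i q * Av (n - i) q) \<le> Av (Suc n) q"
proof -
  define AV where "AV = (\<lambda>n. {p \<in> perms_of_length n. avoids_pattern p q})"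
  let ?D = "SIGMA i:{..n}. AV i \<times> AV (n - i)"
  have fin: "finite (AV i)" for i
    by (simp add: AV_def)
  have "(\<Sum>i\<le>n. Av i q * Av (n - i) q) = card ?D"
    using fin by (simp add: Av_def AV_def card_cartesian_product)
  also have "\<dots> \<le> card (AV (Suc n))"
  proof (rule card_inj_on_le)
    show "inj_on (\<lambda>(i, \<sigma>, \<pi>). skew_glue \<sigma> \<pi>) ?D"
    proof (rule inj_onI)
      fix x y assume "x \<in> ?D" "y \<in> ?D"
        and eq: "(\<lambda>(i, \<sigma>, \<pi>). skew_glue \<sigma> \<pi>) x = (\<lambda>(i, \<sigma>, \<pi>). skew_glue \<sigma> \<pi>) y"
      then obtain i \<sigma> \<pi> i' \<sigma>' \<pi>' where xy: "x = (i, \<sigma>, \<pi>)" "y = (i', \<sigma>', \<pi>')"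
        and mem: "\<sigma> \<in> perms_of_length i" "\<pi> \<in> perms_of_length (n - i)"
          "\<sigma>' \<in> perms_of_length i'" "\<pi>' \<in> perms_of_length (n - i')" and "i + (n - i) = i' + (n - i')"
        by (cases x, cases y) (auto simp: AV_def)
      then have "\<sigma> = \<sigma>' \<and> \<pi> = \<pi>'"
        using eq by (intro skew_glue_inject[OF mem(1-4)]) auto
      \<comment> \<open>The index \<open>i\<close> is recovered as the length of
        \<open>\<sigma>\<close>.\<close>
      then show "x = y"
        using xy length_perm mem(1,3) by blast
    qed
    show "(\<lambda>(i, \<sigma>, \<pi>). skew_glue \<sigma> \<pi>) ` ?D \<subseteq> AV (Suc n)"
    proof clarify
      fix i \<sigma> \<pi> assume "i \<le> n" "\<sigma> \<in> AV i" "\<pi> \<in> AV (n - i)"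
      then show "skew_glue \<sigma> \<pi> \<in> AV (Suc n)"
        using skew_glue_perm[of \<sigma> i \<pi> "n - i"] skew_glue_avoids[of \<sigma> i \<pi> "n - i" q k] q
        by (simp add: AV_def)
    qed
  qed (simp add: fin)
  finally show ?thesis
    by (simp add: Av_def AV_def)
qed

section \<open>Irrationality of the generating functions\<close>

lemma Av_gf_not_rational_skew_indecomposable:
  assumes "q \<in> perms_of_length k" "k > 0" "\<not> skew_decomposable q" "last q \<noteq> k"
  shows "\<not> rational_fps (Av_gf q)"
proof -
  have "q \<noteq> []"
    using assms length_perm[OF assms(1)] by auto
  then show ?thesis
    unfolding Av_gf_def
    by (intro catalan_recursion_not_rational Av_0 Av_catalan_recursion[OF assms])
qed

text \<open>Some symmetry of \<open>q\<close> is skew indecomposable and does not end in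
  \<open>k\<close>. If \<open>q\<close> is decomposable, its reverse and its complement are not;
  they end in \<open>hd q\<close> and \<open>k + 1 - last q\<close>, and the condition on the ends
  prevents both from being \<open>k\<close>. If \<open>q\<close> is indecomposable but ends in
  \<open>k\<close>, then \<open>hd q\<close> is not 1, and the reverse complement ends in
  \<open>k + 1 - hd q\<close>, which differs from \<open>k\<close>.\<close>

lemma Av_gf_not_rational:
  assumes q: "q \<in> perms_of_length k" and "k > 0" and ends: "{1, k} \<noteq> {hd q, last q}"
  shows "\<not> rational_fps (Av_gf q)"
proof -
  have len: "length q = k" and ne: "q \<noteq> []"
    using length_perm[OF q] \<open>k > 0\<close> by auto
  have bounds: "hd q \<in> {1..k}" "last q \<in> {1..k}"
    using q hd_in_set[OF ne] last_in_set[OF ne] by (auto simp: perms_of_length_iff)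
  have gf_rev: "Av_gf (rev p) = Av_gf p" for p
    by (simp add: Av_gf_def Av_rev)
  have gf_complement: "Av_gf (complement p) = Av_gf p" if "p \<in> perms_of_length k" for p
    using that by (simp add: Av_gf_def Av_complement)
  note indec = Av_gf_not_rational_skew_indecomposable[OF _ \<open>k > 0\<close>]
  show ?thesis
  proof (cases "skew_decomposable q")
    case True
    then have less: "last q < hd q"
      by (rule skew_decomposable_hd_last)
    consider "hd q \<noteq> k" | "last q \<noteq> 1"
      using ends by (auto simp: doubleton_eq_iff)
    then show ?thesis
    proof cases
      case 1
      have "\<not> skew_decomposable (rev q)"
        using skew_decomposable_hd_last[of "rev q"] less ne by (auto simp: hd_rev last_rev)
      then have "\<not> rational_fps (Av_gf (rev q))"
        using 1 by (intro indec rev_perm q) (simp_all add: last_rev)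
      then show ?thesis
        by (simp add: gf_rev)
    next
      case 2
      have "\<not> skew_decomposable (complement q)"
        using skew_decomposable_hd_last[of "complement q"] less ne
        by (auto simp: hd_complement last_complement)
      then have "\<not> rational_fps (Av_gf (complement q))"
        using 2 bounds by (intro indec complement_perm q) (auto simp: last_complement ne len)
      then show ?thesis
        by (simp add: gf_complement q)
    qed
  next
    case False
    show ?thesis
    proof (cases "last q = k")
      case True
      then have "hd q \<noteq> 1"
        using ends by auto
      moreover have "\<not> skew_decomposable (complement (rev q))"
        using False skew_decomposable_complement_rev[OF q] by blast
      ultimately have "\<not> rational_fps (Av_gf (complement (rev q)))"
        using bounds by (intro indec complement_perm rev_perm q)
          (auto simp: last_complement last_rev ne len)
      then show ?thesis
        by (simp add: gf_complement gf_rev rev_perm q)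
    next
      case last: False
      then show ?thesis
        using False by (intro indec q)
    qed
  qed
qed

text \<open>Wilf equivalence covers only lengths from 1 on; the constant coefficients agree because
  both patterns are nonempty.\<close>

lemma wilf_equivalent_Av_gf:
  assumes "wilf_equivalent q v" "q \<noteq> []" "v \<noteq> []"
  shows "Av_gf q = Av_gf v"
proof -
  have "Av n q = Av n v" for n
    using assms by (cases "n = 0") (auto simp: wilf_equivalent_def Av_0)
  then show ?thesis
    by (simp add: Av_gf_def)
qed

theorem theorem5p1:
  fixes k :: nat and q :: "nat list"
  assumes "k \<ge> 1"
    and "q \<in> perms_of_length k"
    and "{1, k} \<noteq> {hd q, last q} \<or>
         (\<exists>v \<in> perms_of_length k. wilf_equivalent q v \<and> {1, k} \<noteq> {hd v, last v})"
  shows "\<not> rational_fps (Av_gf q)"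
proof -
  have nonempty: "p \<noteq> []" if "p \<in> perms_of_length k" for p
    using length_perm[OF that] assms(1) by auto
  \<comment> \<open>If \<open>q\<close> itself satisfies the condition on its ends, \<open>v\<close>
    is \<open>q\<close>.\<close>
  from assms(3) obtain v where "v \<in> perms_of_length k" "{1, k} \<noteq> {hd v, last v}" "Av_gf q = Av_gf v"
    using assms(2) wilf_equivalent_Av_gf nonempty by blast
  then show ?thesis
    using Av_gf_not_rational assms(1) by simp
qed

end
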